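(* Let $\rho,\beta>0$ and let $\phi$ be a Ma-Minda function. Then there exists an $\alpha\in(0,1]$ such that $\{w:|w-1|<\alpha\}$ is the largest open disk centered at $1$ contained in $\phi(\mathbb D)$ and, whenever $\phi(-1)=1-\alpha$, $$R[\mathcal C(\phi)]=R[\mathcal C(1+\alpha z)]$$ for each of the normalized Wright functions $f_{\rho,\beta}$, $g_{\rho,\beta}$ and $h_{\rho,\beta}$.
   Context: Wright function: $\Phi(\rho,\beta,z)=\sum_{n\ge0}\frac{z^n}{n!\,\Gamma(n\rho+\beta)}$. Normalized Wright functions: $f_{\rho,\beta}(z)=[z^\beta\Gamma(\beta)\Phi(\rho,\beta,-z^2)]^{1/\beta}$, i.e. $z\,(\Gamma(\beta)\Phi(\rho,\beta,-z^2))^{1/\beta}$ with the branch of the power equal to $1$ at $z=0$; $g_{\rho,\beta}(z)=z\Gamma(\beta)\Phi(\rho,\beta,-z^2)$; $h_{\rho,\beta}(z)=z\Gamma(\beta)\Phi(\rho,\beta,-z)$. $\mathbb D$ is the open unit disk, $\mathcal A$ the analytic functions $f$ on $\mathbb D$ with $f(0)=0$, $f'(0)=1$. A Ma-Minda function is an analytic univalent $\phi$ on $\mathbb D$ with $\Re\phi>0$, $\phi(0)=1$, $\phi'(0)>0$, and $\phi(\mathbb D)$ starlike with respect to $1$ and symmetric about the real axis; $\phi(-1)$ means $\lim_{x\to-1^+}\phi(x)$. $\mathcal C(\phi)=\{f\in\mathcal A: 1+zf''(z)/f'(z)\prec\phi(z)\}$, where $\prec$ is subordination; since $\phi$ is univalent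 this means $1+zf''(z)/f'(z)\in\phi(\mathbb D)$ on $\mathbb D$. The case $\phi(z)=1+\alpha z$ gives $\mathcal C(1+\alpha z)$. Radius: for a function $f$ analytic near $0$ with $f(0)=0$, $f'(0)=1$, the $\mathcal C(\phi)$-radius $R[\mathcal C(\phi)]$ of $f$ is the largest $r_0>0$ (not required to be $\le1$) such that $f$ belongs to the class in $|z|<r_0$: $f$ is analytic with $f'\neq0$ there, and $1+zf''(z)/f'(z)\in\phi(\mathbb D)$ for all $|z|<r_0$. *)

theory Defs
  imports "HOL-Complex_Analysis.Complex_Analysis"
begin

definition wright :: "real \<Rightarrow> real \<Rightarrow> complex \<Rightarrow> complex" where
  "wright \<rho> \<beta> z = (\<Sum>n. z ^ n / (fact n * of_real (Gamma (real n * \<rho> + \<beta>))))"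

(* The base of the power is 1 at z = 0, so near 0 the principal power is the branch with value 1
   there.  Away from 0 it may jump across the cut of Ln: only the germ of wright_f at 0 is
   meaningful, and convex_type_in below depends on nothing else. *)
definition wright_f :: "real \<Rightarrow> real \<Rightarrow> complex \<Rightarrow> complex" where
  "wright_f \<rho> \<beta> z = z * (of_real (Gamma \<beta>) * wright \<rho> \<beta> (- z\<^sup>2)) powr of_real (1 / \<beta>)"

definition wright_g :: "real \<Rightarrow> real \<Rightarrow> complex \<Rightarrow> complex" where
  "wright_g \<rho> \<beta> z = z * of_real (Gamma \<beta>) * wright \<rho> \<beta> (- z\<^sup>2)"

definition wright_h :: "real \<Rightarrow> real \<Rightarrow> complex \<Rightarrow> complex" where
  "wright_h \<rho> \<beta> z = z * of_real (Gamma \<beta>) * wright \<rho> \<beta> (- z)"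

definition ma_minda :: "(complex \<Rightarrow> complex) \<Rightarrow> bool" where
  "ma_minda \<phi> \<longleftrightarrow>
     \<phi> holomorphic_on ball 0 1 \<and> inj_on \<phi> (ball 0 1) \<and>
     (\<forall>z\<in>ball 0 1. Re (\<phi> z) > 0) \<and>
     \<phi> 0 = 1 \<and> Im (deriv \<phi> 0) = 0 \<and> Re (deriv \<phi> 0) > 0 \<and>
     (\<forall>w\<in>\<phi> ` ball 0 1. closed_segment 1 w \<subseteq> \<phi> ` ball 0 1) \<and>
     (\<forall>w\<in>\<phi> ` ball 0 1. cnj w \<in> \<phi> ` ball 0 1)"

(* The germ of f at 0 continues analytically to F on |z| < r, and F satisfies the condition
   defining the class C(\<phi>) there.  F is unique on the disk by the identity theorem; if f itself
   is holomorphic on the disk then F = f there. *)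
definition convex_type_in :: "(complex \<Rightarrow> complex) \<Rightarrow> (complex \<Rightarrow> complex) \<Rightarrow> real \<Rightarrow> bool" where
  "convex_type_in \<phi> f r \<longleftrightarrow>
     (\<exists>F. F holomorphic_on ball 0 r \<and> (\<forall>\<^sub>F z in nhds 0. F z = f z) \<and>
          (\<forall>z\<in>ball 0 r. deriv F z \<noteq> 0 \<and>
             1 + z * deriv (deriv F) z / deriv F z \<in> \<phi> ` ball 0 1))"

(* R is the C(\<phi>)-radius of f; such an R is unique when it exists. *)
definition is_C_radius :: "(complex \<Rightarrow> complex) \<Rightarrow> (complex \<Rightarrow> complex) \<Rightarrow> real \<Rightarrow> bool" where
  "is_C_radius \<phi> f R \<longleftrightarrow>
     R > 0 \<and> convex_type_in \<phi> f R \<and> (\<forall>r>0. convex_type_in \<phi> f r \<longrightarrow> r \<le> R)"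

end

theory Submission imports Defs begin

text \<open>
  Let \<open>p\<close> be the power series of \<open>\<Gamma>(\<beta>) \<Phi>(\<rho>, \<beta>, -w)\<close>. The key fact is that
  \<open>q = - w p'/p\<close> has nonnegative coefficients. It needs no information on the zeros of \<open>p\<close>:
  the series \<open>p\<close> with \<open>q \<ge> 0\<close> contain \<open>exp (-t w)\<close> and are closed under coefficientwise limits and
  under \<open>p \<mapsto> (d + c w d/dw) p\<close>, because the latter equals \<open>p (d - c q)\<close>. By the limit formula
  \<open>1/\<Gamma>(x) = lim x (x+1) \<dots> (x+m) / (m! m\<^sup>x)\<close>, the Wright series is such a limit.

  Each of the three normalized functions has a germ \<open>F = z exp (s log p(z\<^sup>k))\<close> with \<open>(s, k)\<close> equal to
  \<open>(1/\<beta>, 2)\<close>, \<open>(1, 2)\<close>, \<open>(1, 1)\<close>, and with \<open>c = s k\<close>, \<open>w = z\<^sup>k\<close>,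
  \<open>- z F''/F' = c q(w) + c k w q'(w) / (1 - c q(w))\<close>.
  As long as \<open>c q(|w|) < 1\<close>, its modulus is at most its value at \<open>|z|\<close>. Since \<open>q\<close> is unbounded before
  the first zero of \<open>p\<close>, there is a least \<open>R\<close> where this value equals \<open>\<alpha>\<close>. On \<open>|z| < R\<close> the
  quantity \<open>1 + z F''/F'\<close> stays in the disk of radius \<open>\<alpha>\<close> about \<open>1\<close>, and at \<open>z = R\<close> it equals
  \<open>1 - \<alpha> = \<phi>(-1)\<close>, which is not in the image of \<open>\<phi>\<close>.
\<close>

unbundle no vec_syntax

section \<open>Power series with nonnegative negated logarithmic derivative\<close>

lemma fps_mult_nonneg:
  fixes f g :: "real fps"
  assumes "\<And>n. f $ n \<ge> 0" "\<And>n. g $ n \<ge> 0"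
  shows "(f * g) $ n \<ge> 0"
  using assms by (auto simp: fps_mult_nth intro!: sum_nonneg)

text \<open>Comparing coefficients in \<open>f * inverse f = 1\<close> expresses
  \<open>f $ 0 * inverse f $ n\<close> through earlier coefficients of the inverse with the weights
  \<open>- f $ i\<close>, which are nonnegative.\<close>

lemma fps_inverse_nonneg:
  fixes f :: "real fps"
  assumes pos: "f $ 0 > 0" and neg: "\<And>n. n > 0 \<Longrightarrow> f $ n \<le> 0"
  shows "inverse f $ n \<ge> 0"
proof (induction n rule: less_induct)
  case (less n)
  show ?case
  proof (cases n)
    case (Suc m)
    have "(f * inverse f) $ n = 0"
      using pos Suc by (simp add: inverse_mult_eq_1')
    then have "f $ 0 * inverse f $ n = (\<Sum>i=1..n. - f $ i * inverse f $ (n - i))"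
      by (simp add: fps_mult_nth sum.atLeast_Suc_atMost sum_negf)
    also have "\<dots> \<ge> 0"
      using less.IH neg Suc by (intro sum_nonneg mult_nonneg_nonneg) auto
    finally show ?thesis
      using pos by (simp add: zero_le_mult_iff)
  qed (use pos in simp)
qed

lemma fps_X_mult_deriv_nth: "(fps_X * fps_deriv p) $ n = of_nat n * p $ n"
  for p :: "'a :: comm_ring_1 fps"
  by (cases n) auto

text \<open>The factor \<open>fps_X\<close> turns the derivative into the Euler operator, which
  keeps every index in place and multiplies the n-th coefficient by n.\<close>

definition neg_log_deriv :: "real fps \<Rightarrow> real fps" where
  "neg_log_deriv p = - (fps_X * fps_deriv p) * inverse p"

lemma neg_log_deriv_eqI:
  assumes "p $ 0 \<noteq> 0" "fps_X * fps_deriv p = - (q * p)"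
  shows "neg_log_deriv p = q"
  using assms by (simp add: neg_log_deriv_def mult.assoc inverse_mult_eq_1')

lemma neg_log_deriv_mult:
  assumes "p $ 0 \<noteq> 0"
  shows "neg_log_deriv p * p = - (fps_X * fps_deriv p)"
  using assms by (simp add: neg_log_deriv_def mult.assoc inverse_mult_eq_1)

lemma neg_log_deriv_0 [simp]: "neg_log_deriv p $ 0 = 0"
  by (simp add: neg_log_deriv_def)

definition neg_log_mono :: "real fps \<Rightarrow> bool" where
  "neg_log_mono p \<longleftrightarrow> p $ 0 > 0 \<and> (\<forall>n. neg_log_deriv p $ n \<ge> 0)"

(* With q = - X p'/p the new series is p * (d - c q), and - log (d - c q) has nonnegative
   coefficients whenever q has. *)
lemma neg_log_mono_euler:
  assumes p: "neg_log_mono p" and "d > 0" "c \<ge> 0"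
  shows "neg_log_mono (fps_const d * p + fps_const c * (fps_X * fps_deriv p))"
proof -
  define q where "q = neg_log_deriv p"
  define u where "u = fps_const d - fps_const c * q"
  have p0: "p $ 0 > 0" and q: "\<And>n. q $ n \<ge> 0" "q $ 0 = 0"
    using p by (auto simp: neg_log_mono_def q_def)
  have qp: "fps_X * fps_deriv p = - (q * p)"
    using neg_log_deriv_mult[of p] p0 by (simp add: q_def)
  have un: "u $ n \<le> 0" if "n > 0" for n
    using q that assms by (auto simp: u_def)
  have u0: "u $ 0 > 0" using q assms by (auto simp: u_def)
  have eq: "fps_const d * p + fps_const c * (fps_X * fps_deriv p) = p * u"
    unfolding qp u_def by (simp add: algebra_simps)
  \<comment> \<open>By the product rule for logarithmic derivatives, \<open>q1\<close> has to be
    \<open>q\<close> minus X u'/u, and u' = - c q'. Its coefficients are nonnegative because those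
    of \<open>inverse u\<close> are.\<close>
  define q1 where "q1 = q + fps_const c * (fps_X * fps_deriv q) * inverse u"
  have "q1 * u = q * u + fps_const c * (fps_X * fps_deriv q)"
    using u0 by (simp add: q1_def distrib_right mult.assoc inverse_mult_eq_1)
  moreover have "fps_X * fps_deriv (p * u) = (fps_X * fps_deriv p) * u - p * (fps_const c * (fps_X * fps_deriv q))"
    by (simp add: u_def algebra_simps)
  ultimately have "fps_X * fps_deriv (p * u) = - (q1 * (p * u))"
    unfolding qp by (simp add: algebra_simps)
  then have "neg_log_deriv (p * u) = q1"
    using p0 u0 by (intro neg_log_deriv_eqI) auto
  moreover have "q1 $ n \<ge> 0" for n
    unfolding q1_def fps_add_nth
    using q assms u0 un
    by (intro add_nonneg_nonneg fps_mult_nonneg fps_inverse_nonneg) (auto simp: fps_X_mult_nth)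
  ultimately show ?thesis
    unfolding eq neg_log_mono_def using p0 u0 by auto
qed

text \<open>Reading off the n-th coefficient of q p = - X p' determines the n-th coefficient of q
  from its predecessors and finitely many coefficients of p, dividing only by the constant one. So
  convergence passes along this recursion.\<close>

lemma tendsto_neg_log_deriv:
  assumes lim: "\<And>n. (\<lambda>m. p m $ n) \<longlonglongrightarrow> p' $ n"
    and p0: "\<And>m. p m $ 0 \<noteq> 0" "p' $ 0 \<noteq> 0"
  shows "(\<lambda>m. neg_log_deriv (p m) $ n) \<longlonglongrightarrow> neg_log_deriv p' $ n"
proof (induction n rule: less_induct)
  case (less n)
  have rec: "neg_log_deriv r $ n =
      (- (real n * r $ n) - (\<Sum>i<n. neg_log_deriv r $ i * r $ (n - i))) / r $ 0"
    if "r $ 0 \<noteq> 0" for r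
  proof -
    have "(neg_log_deriv r * r) $ n = - (real n * r $ n)"
      unfolding neg_log_deriv_mult[OF that] by (simp add: fps_X_mult_deriv_nth del: fps_X_mult_nth)
    moreover have "(neg_log_deriv r * r) $ n =
        neg_log_deriv r $ n * r $ 0 + (\<Sum>i<n. neg_log_deriv r $ i * r $ (n - i))"
      by (cases n) (simp_all add: fps_mult_nth atLeast0AtMost lessThan_Suc_atMost)
    ultimately show ?thesis using that by (simp add: field_simps)
  qed
  show ?case
    unfolding rec[OF p0(1)] rec[OF p0(2)]
    by (intro tendsto_intros lim p0 less.IH) auto
qed

lemma neg_log_mono_limit:
  assumes "\<And>n. (\<lambda>m. p m $ n) \<longlonglongrightarrow> p' $ n" "\<And>m. neg_log_mono (p m)" "p' $ 0 > 0"
  shows "neg_log_mono p'"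
proof -
  have "(\<lambda>m. neg_log_deriv (p m) $ n) \<longlonglongrightarrow> neg_log_deriv p' $ n" for n
    by (intro tendsto_neg_log_deriv assms) (use assms in \<open>metis neg_log_mono_def less_irrefl\<close>)+
  then have "neg_log_deriv p' $ n \<ge> 0" for n
    by (rule LIMSEQ_le_const) (use assms in \<open>auto simp: neg_log_mono_def\<close>)
  then show ?thesis using assms by (simp add: neg_log_mono_def)
qed

section \<open>The Wright series as a limit of Euler operators applied to exponentials\<close>

lemma neg_log_mono_exp:
  assumes "t \<ge> 0"
  shows "neg_log_mono (fps_exp (- t))"
proof -
  have "neg_log_deriv (fps_exp (- t)) = fps_const t * fps_X"
    by (intro neg_log_deriv_eqI) (simp_all flip: fps_const_neg)
  then show ?thesis using assms by (simp add: neg_log_mono_def)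
qed

text \<open>Raising \<open>k\<close> by one multiplies the n-th coefficient by n \<rho> + \<beta> +
  k. This is the action of the operator (\<beta> + k) + \<rho> w d/dw, covered by
  \<open>neg_log_mono_euler\<close>; the induction starts from an exponential.\<close>

lemma neg_log_mono_exp_pochhammer:
  assumes "\<rho> > 0" "\<beta> > 0" "t \<ge> 0"
  shows "neg_log_mono (Abs_fps (\<lambda>n. (- t) ^ n / fact n * pochhammer (real n * \<rho> + \<beta>) k))"
proof (induction k)
  case 0
  have "Abs_fps (\<lambda>n. (- t) ^ n / fact n * pochhammer (real n * \<rho> + \<beta>) 0) = fps_exp (- t)"
    by (simp add: fps_exp_def)
  then show ?case using neg_log_mono_exp[OF assms(3)] by simp
next
  case (Suc k)
  define p where "p = Abs_fps (\<lambda>n. (- t) ^ n / fact n * pochhammer (real n * \<rho> + \<beta>) k)"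
  have "Abs_fps (\<lambda>n. (- t) ^ n / fact n * pochhammer (real n * \<rho> + \<beta>) (Suc k)) =
        fps_const (\<beta> + real k) * p + fps_const \<rho> * (fps_X * fps_deriv p)"
  proof (rule fps_ext)
    fix n
    show "Abs_fps (\<lambda>n. (- t) ^ n / fact n * pochhammer (real n * \<rho> + \<beta>) (Suc k)) $ n =
        (fps_const (\<beta> + real k) * p + fps_const \<rho> * (fps_X * fps_deriv p)) $ n"
      unfolding fps_add_nth fps_mult_left_const_nth fps_X_mult_deriv_nth
      by (simp add: p_def pochhammer_Suc algebra_simps add_divide_distrib)
  qed
  then show ?case
    using neg_log_mono_euler[of p "\<beta> + real k" \<rho>] Suc assms by (simp add: p_def)
qed

lemma neg_log_mono_cmult:
  assumes "neg_log_mono p" "c > 0"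
  shows "neg_log_mono (fps_const c * p)"
  using neg_log_mono_euler[OF assms, of 0] by simp

lemma neg_log_mono_wright:
  assumes "\<rho> > 0" "\<beta> > 0"
  shows "neg_log_mono (Abs_fps (\<lambda>n. Gamma \<beta> * (-1) ^ n / (fact n * Gamma (real n * \<rho> + \<beta>))))"
proof -
  \<comment> \<open>In \<open>rGamma_series\<close> at n \<rho> + \<beta> the denominator contains m
    to the power n \<rho> + \<beta>. Its part depending on n is absorbed into the parameter
    \<open>t m\<close> of the exponential, the rest into the scalar \<open>c m\<close>. Writing
    powers through \<open>exp\<close> keeps both positive for m = 0 too.\<close>
  define t where "t m = exp (- \<rho> * ln (real m))" for m
  define c where "c m = Gamma \<beta> / (fact m * exp (\<beta> * ln (real m)))" for m
  define p where "p m = fps_const (c m) *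
    Abs_fps (\<lambda>n. (- t m) ^ n / fact n * pochhammer (real n * \<rho> + \<beta>) (m + 1))" for m
  have *: "p m $ n = Gamma \<beta> * (-1) ^ n / fact n * rGamma_series (real n * \<rho> + \<beta>) m" for m n
  proof -
    have "(- t m) ^ n = (-1) ^ n * t m ^ n"
      by (metis mult_minus1 power_mult_distrib)
    moreover have "exp ((real n * \<rho> + \<beta>) * ln (real m)) * t m ^ n = exp (\<beta> * ln (real m))"
      by (simp add: t_def exp_of_nat_mult[symmetric] exp_add[symmetric] algebra_simps)
    ultimately show ?thesis
      by (simp add: p_def c_def rGamma_series_def field_simps)
  qed
  show ?thesis
  proof (rule neg_log_mono_limit[of p])
    show "(\<lambda>m. p m $ n) \<longlonglongrightarrow>
        Abs_fps (\<lambda>n. Gamma \<beta> * (-1) ^ n / (fact n * Gamma (real n * \<rho> + \<beta>))) $ n" for n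
      unfolding * using tendsto_mult_left[OF rGamma_series_LIMSEQ[of "real n * \<rho> + \<beta>"],
        of "Gamma \<beta> * (-1) ^ n / fact n"]
      by (simp add: rGamma_inverse_Gamma divide_inverse mult_ac)
    show "neg_log_mono (p m)" for m
      unfolding p_def using assms
      by (intro neg_log_mono_cmult neg_log_mono_exp_pochhammer) (auto simp: t_def c_def)
  qed (use Gamma_real_pos[OF assms(2)] in simp)
qed

section \<open>Growth on the positive axis\<close>

text \<open>Signs of coefficients are studied over the reals, zeros and holomorphy over the complex
  numbers; this embedding links the two.\<close>

definition complex_fps :: "real fps \<Rightarrow> complex fps" where
  "complex_fps p = Abs_fps (\<lambda>n. of_real (p $ n))"

lemma complex_fps_nth [simp]: "complex_fps p $ n = of_real (p $ n)"
  by (simp add: complex_fps_def)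

lemma complex_fps_mult: "complex_fps (p * q) = complex_fps p * complex_fps q"
  by (rule fps_ext) (simp add: fps_mult_nth)

lemma neg_log_deriv_complex:
  assumes "p $ 0 \<noteq> 0"
  shows "complex_fps (neg_log_deriv p) * complex_fps p = - (fps_X * fps_deriv (complex_fps p))"
proof (rule fps_ext)
  fix n
  have "(neg_log_deriv p * p) $ n = - (real n * p $ n)"
    unfolding neg_log_deriv_mult[OF assms] by (simp add: fps_X_mult_deriv_nth del: fps_X_mult_nth)
  then show "(complex_fps (neg_log_deriv p) * complex_fps p) $ n =
      (- (fps_X * fps_deriv (complex_fps p))) $ n"
    unfolding complex_fps_mult[symmetric] fps_neg_nth fps_X_mult_deriv_nth by simp
qed

context
  fixes q :: "real fps"
  assumes nonneg: "\<And>n. q $ n \<ge> 0"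
begin

lemma sums_eval_complex_fps:
  assumes "r \<ge> 0" "r < fps_conv_radius (complex_fps q)"
  shows "(\<lambda>n. q $ n * r ^ n) sums Re (eval_fps (complex_fps q) (of_real r))"
    and "Im (eval_fps (complex_fps q) (of_real r)) = 0"
proof -
  have *: "(\<lambda>n. complex_of_real (q $ n * r ^ n)) sums eval_fps (complex_fps q) (of_real r)"
    using sums_eval_fps[of "of_real r" "complex_fps q"] assms by simp
  from sums_Re[OF this] show "(\<lambda>n. q $ n * r ^ n) sums Re (eval_fps (complex_fps q) (of_real r))"
    by simp
  have "(\<lambda>n. 0) sums Im (eval_fps (complex_fps q) (of_real r))"
    using sums_Im[OF *] by simp
  then show "Im (eval_fps (complex_fps q) (of_real r)) = 0"
    by (metis sums_0 sums_unique2)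
qed

text \<open>Triangle inequality term by term: with nonnegative coefficients the majorant is the
  series itself at \<open>norm z\<close>.\<close>

lemma norm_eval_complex_fps_le:
  assumes "norm z < fps_conv_radius (complex_fps q)"
  shows "norm (eval_fps (complex_fps q) z) \<le> Re (eval_fps (complex_fps q) (of_real (norm z)))"
proof -
  have s: "(\<lambda>n. q $ n * norm z ^ n) sums Re (eval_fps (complex_fps q) (of_real (norm z)))"
    by (rule sums_eval_complex_fps) (use assms in auto)
  have "norm (eval_fps (complex_fps q) z) \<le> (\<Sum>n. q $ n * norm z ^ n)"
    unfolding eval_fps_def
    by (rule norm_suminf_le[OF _ sums_summable[OF s]]) (simp add: norm_mult norm_power nonneg)
  then show ?thesis using s by (simp add: sums_iff)
qed

lemma eval_complex_fps_mono:
  assumes "0 \<le> r" "r \<le> r'" "r' < fps_conv_radius (complex_fps q)"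
  shows "Re (eval_fps (complex_fps q) (of_real r)) \<le> Re (eval_fps (complex_fps q) (of_real r'))"
proof (rule sums_le)
  show "(\<lambda>n. q $ n * r ^ n) sums Re (eval_fps (complex_fps q) (of_real r))"
    using assms by (intro sums_eval_complex_fps) (auto intro: le_less_trans[of _ "ereal r'"])
  show "(\<lambda>n. q $ n * r' ^ n) sums Re (eval_fps (complex_fps q) (of_real r'))"
    using assms by (intro sums_eval_complex_fps) auto
qed (use assms nonneg in \<open>auto intro!: mult_left_mono power_mono\<close>)

text \<open>All terms but the linear one are dropped. This gives unboundedness when the series
  converges everywhere.\<close>

lemma eval_complex_fps_ge_linear:
  assumes "0 \<le> r" "r < fps_conv_radius (complex_fps q)"
  shows "q $ 1 * r \<le> Re (eval_fps (complex_fps q) (of_real r))"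
proof (rule sums_le)
  show "(\<lambda>n. q $ n * r ^ n) sums Re (eval_fps (complex_fps q) (of_real r))"
    using assms by (intro sums_eval_complex_fps) auto
  show "(\<lambda>n. if n = 1 then q $ n * r ^ n else 0) sums (q $ 1 * r)"
    using sums_single[of 1 "\<lambda>n. q $ n * r ^ n"] by simp
qed (use assms nonneg in auto)

end

section \<open>The negated logarithmic derivative up to the first zero\<close>

text \<open>The series is the product of an everywhere convergent one with
  \<open>inverse ?P\<close>, and the latter converges on every disk free of zeros of the entire
  function.\<close>

lemma fps_conv_radius_neg_log_deriv:
  assumes p: "p $ 0 \<noteq> 0" "fps_conv_radius (complex_fps p) = \<infinity>"
    and nz: "\<And>w. ereal (norm w) < r \<Longrightarrow> eval_fps (complex_fps p) w \<noteq> 0"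
  shows "fps_conv_radius (complex_fps (neg_log_deriv p)) \<ge> r"
proof -
  let ?P = "complex_fps p"
  have "complex_fps (neg_log_deriv p) * ?P * inverse ?P = - (fps_X * fps_deriv ?P) * inverse ?P"
    unfolding neg_log_deriv_complex[OF p(1)] ..
  then have "complex_fps (neg_log_deriv p) = - (fps_X * fps_deriv ?P) * inverse ?P"
    using p(1) by (simp add: mult.assoc inverse_mult_eq_1')
  moreover have "fps_conv_radius (inverse ?P) \<ge> r"
    using fps_conv_radius_inverse[of r ?P, OF nz] p(2) by simp
  moreover have "fps_conv_radius (- (fps_X * fps_deriv ?P)) \<ge> \<infinity>"
    using fps_conv_radius_mult[of fps_X "fps_deriv ?P"] fps_conv_radius_deriv[of ?P] p(2) by simp
  ultimately show ?thesis
    using fps_conv_radius_mult[of "- (fps_X * fps_deriv ?P)" "inverse ?P"] by (auto simp: min_def split: if_splits)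
qed

lemma eval_neg_log_deriv:
  assumes p: "p $ 0 \<noteq> 0" "fps_conv_radius (complex_fps p) = \<infinity>"
    and w: "norm w < fps_conv_radius (complex_fps (neg_log_deriv p))"
  shows "eval_fps (complex_fps (neg_log_deriv p)) w * eval_fps (complex_fps p) w =
         - (w * deriv (eval_fps (complex_fps p)) w)"
proof -
  let ?P = "complex_fps p"
  have rad: "fps_conv_radius (fps_deriv ?P) = \<infinity>"
    using fps_conv_radius_deriv[of ?P] p(2) by simp
  have rad2: "fps_conv_radius (fps_X * fps_deriv ?P) = \<infinity>"
    using fps_conv_radius_mult[of fps_X "fps_deriv ?P"] rad by simp
  have "eval_fps (complex_fps (neg_log_deriv p)) w * eval_fps ?P w =
        eval_fps (- (fps_X * fps_deriv ?P)) w"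
    unfolding neg_log_deriv_complex[OF p(1), symmetric] using w p by (simp add: eval_fps_mult)
  also have "\<dots> = - (w * deriv (eval_fps ?P) w)"
    using p rad rad2 by (simp add: eval_fps_minus eval_fps_mult eval_fps_deriv)
  finally show ?thesis .
qed

text \<open>The point \<open>a\<close> rules out that f vanishes identically, by the identity
  theorem. The zero therefore has finite order, and the logarithmic derivative has a pole
  there.\<close>

lemma is_pole_logderiv_zero:
  fixes f :: "complex \<Rightarrow> complex"
  assumes "f holomorphic_on UNIV" "f \<zeta> = 0" "f a \<noteq> 0"
  shows "is_pole (\<lambda>z. deriv f z / f z) \<zeta>"
proof -
  have an: "f analytic_on {\<zeta>}"
    using assms(1) analytic_on_holomorphic by blast
  let ?F = "fps_expansion f \<zeta>"
  have F: "(\<lambda>w. f (\<zeta> + w)) has_fps_expansion ?F"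
    using an by (rule analytic_at_imp_has_fps_expansion)
  have "?F \<noteq> 0"
  proof
    assume "?F = 0"
    with F have "\<forall>\<^sub>F w in nhds 0. 0 = f (\<zeta> + w)"
      by (simp add: has_fps_expansion_def)
    then have "\<forall>\<^sub>F w in nhds 0. f (\<zeta> + w) = 0"
      by (rule eventually_mono) simp
    then obtain S where S: "open S" "0 \<in> S" "\<And>w. w \<in> S \<Longrightarrow> f (\<zeta> + w) = 0"
      by (auto simp: eventually_nhds)
    have "(f \<circ> (\<lambda>w. \<zeta> + w)) holomorphic_on UNIV"
      by (intro holomorphic_on_compose holomorphic_intros holomorphic_on_subset[OF assms(1)]) auto
    then have "(\<lambda>w. f (\<zeta> + w)) holomorphic_on UNIV"
      by (simp add: o_def)
    then have "f (\<zeta> + (a - \<zeta>)) = 0"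
      using S by (intro analytic_continuation_open[of S UNIV "\<lambda>w. f (\<zeta> + w)" "\<lambda>_. 0" "a - \<zeta>"]) auto
    with assms show False by simp
  qed
  moreover have "f \<midarrow>\<zeta>\<rightarrow> 0"
    using an assms(2) by (metis analytic_at_imp_isCont isCont_def)
  ultimately show ?thesis
    using is_pole_deriv_divide_iff[OF has_laurent_expansion_fps[OF F]] by simp
qed

(* If p has a zero, then X p'/p has a pole at a zero of least modulus; on the disk up to that zero
   the series of - X p'/p is bounded by its values on the positive axis, so these are unbounded. *)
lemma neg_log_deriv_unbounded:
  assumes p: "neg_log_mono p" "p $ 1 \<noteq> 0" "fps_conv_radius (complex_fps p) = \<infinity>"
  obtains r where "r > 0" "r < fps_conv_radius (complex_fps (neg_log_deriv p))"
    "\<And>w. norm w \<le> r \<Longrightarrow> eval_fps (complex_fps p) w \<noteq> 0"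
    "K \<le> Re (eval_fps (complex_fps (neg_log_deriv p)) (of_real r))"
proof -
  define q where "q = neg_log_deriv p"
  define f where "f = eval_fps (complex_fps p)"
  define Q where "Q = eval_fps (complex_fps q)"
  have p0: "p $ 0 > 0" and q: "\<And>n. q $ n \<ge> 0"
    using p(1) by (auto simp: neg_log_mono_def q_def)
  have p0': "p $ 0 \<noteq> 0" using p0 by simp
  have "(q * p) $ 1 = - (real 1 * p $ 1)"
    unfolding q_def neg_log_deriv_mult[OF p0'] by (simp add: fps_X_mult_deriv_nth del: fps_X_mult_nth)
  then have "q $ 1 * p $ 0 = - p $ 1"
    using fps_mult_nth_1[of q p] by (simp add: q_def)
  with p(2) have "q $ 1 \<noteq> 0" by auto
  with q[of 1] have q1: "q $ 1 > 0" by simp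
  have holf: "f holomorphic_on UNIV"
    unfolding f_def by (rule holomorphic_on_eval_fps) (simp add: p)
  have f0: "f 0 \<noteq> 0" using p0 by (simp add: f_def eval_fps_at_0)
  show ?thesis
  proof (cases "\<exists>z. f z = 0")
    case False
    then have rad: "fps_conv_radius (complex_fps q) = \<infinity>"
      using fps_conv_radius_neg_log_deriv[of p \<infinity>, OF p0' p(3)] by (auto simp: f_def q_def)
    \<comment> \<open>At K / q_1 the linear term alone already reaches \<open>K\<close>; the maximum
      with 1 makes \<open>r\<close> positive.\<close>
    define r where "r = max 1 (K / q $ 1)"
    have r: "r > 0" by (simp add: r_def)
    have "K / q $ 1 \<le> r" by (simp add: r_def)
    then have "K \<le> q $ 1 * r" using q1 by (simp add: field_simps)
    also have "\<dots> \<le> Re (Q (of_real r))"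
      unfolding Q_def using r rad by (intro eval_complex_fps_ge_linear q) auto
    finally show ?thesis
      using that[of r] r rad False by (auto simp: Q_def f_def q_def)
  next
    case True
    have "closed {z. f z = 0}"
      using continuous_closed_preimage_constant[of UNIV f 0] holomorphic_on_imp_continuous_on[OF holf] by simp
    then obtain \<zeta> where \<zeta>: "f \<zeta> = 0" "\<And>z. f z = 0 \<Longrightarrow> norm \<zeta> \<le> norm z"
      using distance_attains_inf[of "{z. f z = 0}" 0] True by auto
    define W where "W = norm \<zeta>"
    have W: "W > 0" using \<zeta>(1) f0 by (auto simp: W_def)
    have nz: "f w \<noteq> 0" if "norm w < W" for w
      using \<zeta>(2)[of w] that by (auto simp: W_def)
    have rad: "fps_conv_radius (complex_fps q) \<ge> W"
      unfolding q_def using fps_conv_radius_neg_log_deriv[of p W, OF p0' p(3)] nz by (auto simp: f_def)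
    show ?thesis
    proof (cases "\<exists>r. 0 < r \<and> r < W \<and> K \<le> Re (Q (of_real r))")
      case True
      then obtain r where r: "0 < r" "r < W" "K \<le> Re (Q (of_real r))" by blast
      show ?thesis
      proof (rule that[OF r(1)])
        show "ereal r < fps_conv_radius (complex_fps (neg_log_deriv p))"
          using less_le_trans[OF _ rad, of "ereal r"] r(2) by (simp add: q_def)
        show "eval_fps (complex_fps p) w \<noteq> 0" if "norm w \<le> r" for w
          using nz[of w] that r(2) by (simp add: f_def)
        show "K \<le> Re (eval_fps (complex_fps (neg_log_deriv p)) (of_real r))"
          using r(3) by (simp add: Q_def q_def)
      qed
    next
      case False
      \<comment> \<open>If the values on the positive axis stay below \<open>K\<close>, they bound
        |w f'/f| on the whole disk. The factor 2 comes from dividing by |w|, which is at least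
        W/2.\<close>
      have bound: "norm (deriv f w / f w) \<le> 2 * K / W" if w: "norm w < W" "norm w \<ge> W / 2" for w
      proof -
        have wr: "ereal (norm w) < fps_conv_radius (complex_fps q)"
          using less_le_trans[OF _ rad, of "ereal (norm w)"] w(1) by simp
        have "norm w * norm (deriv f w / f w) = norm (Q w)"
        proof -
          have "Q w * f w = - (w * deriv f w)"
            unfolding Q_def q_def f_def using wr by (intro eval_neg_log_deriv p0' p) (simp add: q_def)
          then have "Q w = - (w * (deriv f w / f w))"
            using nz[OF w(1)] by (simp add: field_simps)
          then show ?thesis by (simp only: norm_minus_cancel norm_mult)
        qed
        also have "norm (Q w) \<le> Re (Q (of_real (norm w)))"
          unfolding Q_def using wr by (intro norm_eval_complex_fps_le q)
        also have "\<dots> \<le> K"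
        proof -
          have "0 < norm w" using w(2) W by linarith
          with False w(1) show ?thesis by (meson linear)
        qed
        finally have "norm w * norm (deriv f w / f w) \<le> K" .
        moreover have "W / 2 * norm (deriv f w / f w) \<le> norm w * norm (deriv f w / f w)"
          using w by (intro mult_right_mono) auto
        ultimately show ?thesis using W by (simp add: field_simps)
      qed
      have "filterlim (\<lambda>z. deriv f z / f z) at_infinity (at \<zeta>)"
        using is_pole_logderiv_zero[OF holf \<zeta>(1) f0] by (simp add: is_pole_def)
      then have "\<forall>\<^sub>F z in at \<zeta>. norm (deriv f z / f z) > max 0 (2 * K / W)"
        unfolding filterlim_at_infinity_conv_norm_at_top filterlim_at_top_dense by blast
      then obtain d where d: "d > 0"
        "\<And>z. z \<noteq> \<zeta> \<Longrightarrow> dist z \<zeta> < d \<Longrightarrow> norm (deriv f z / f z) > 2 * K / W"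
        unfolding eventually_at by auto
      \<comment> \<open>The point t \<zeta> on the segment from 0 to \<zeta> is closer than
        \<open>d\<close> to the pole and still has modulus at least W/2, so both the upper and the
        lower bound apply to it.\<close>
      define t where "t = max (1/2) (1 - d / (2 * W))"
      have t: "1/2 \<le> t" "t < 1" "(1 - t) * W < d"
        using W d(1) by (auto simp: t_def field_simps max_def)
      have "norm (of_real t * \<zeta>) = t * W"
        using t by (simp add: norm_mult W_def)
      moreover have "dist (of_real t * \<zeta>) \<zeta> = (1 - t) * W"
      proof -
        have "of_real t * \<zeta> - \<zeta> = - (of_real (1 - t) * \<zeta>)" by (simp add: algebra_simps)
        then have "norm (of_real t * \<zeta> - \<zeta>) = norm (complex_of_real (1 - t)) * norm \<zeta>"
          by (metis norm_minus_cancel norm_mult)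
        then show ?thesis using t unfolding dist_norm norm_of_real by (simp add: W_def)
      qed
      moreover have "W / 2 \<le> t * W" "t * W < W"
        using t W by simp_all
      ultimately have "norm (deriv f (of_real t * \<zeta>) / f (of_real t * \<zeta>)) \<le> 2 * K / W"
        "norm (deriv f (of_real t * \<zeta>) / f (of_real t * \<zeta>)) > 2 * K / W"
        using t(3) W by (intro bound d(2); force simp: W_def)+
      then show ?thesis by simp
    qed
  qed
qed

section \<open>Ma-Minda functions\<close>

text \<open>The radius is the supremum of all admissible ones. It is positive because the image is
  open, at most 1 because Re \<phi> > 0 keeps 0 out of the image, and attained because an open disk
  is the union of its smaller concentric disks.\<close>

lemma ma_minda_max_disk:
  assumes "ma_minda \<phi>"
  obtains \<alpha> where "0 < \<alpha>" "\<alpha> \<le> 1" "ball 1 \<alpha> \<subseteq> \<phi> ` ball 0 1"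
    "\<And>r. ball 1 r \<subseteq> \<phi> ` ball 0 1 \<Longrightarrow> r \<le> \<alpha>"
proof -
  let ?U = "\<phi> ` ball 0 1"
  have hol: "\<phi> holomorphic_on ball 0 1" and inj: "inj_on \<phi> (ball 0 1)"
    and re: "\<And>z. z \<in> ball 0 1 \<Longrightarrow> Re (\<phi> z) > 0" and one: "\<phi> 0 = 1"
    using assms unfolding ma_minda_def by blast+
  define A where "A = {r. ball 1 r \<subseteq> ?U}"
  have "open ?U"
    by (rule open_mapping_thm3[OF hol open_ball inj])
  moreover have "1 \<in> ?U" using one by (intro image_eqI[of _ _ 0]) auto
  ultimately obtain e where e: "e > 0" "ball 1 e \<subseteq> ?U"
    by (meson openE)
  have le1: "r \<le> 1" if "r \<in> A" for r
  proof (rule ccontr)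
    assume "\<not> r \<le> 1"
    then have "0 \<in> ball (1::complex) r" by simp
    then have "0 \<in> ?U" using that unfolding A_def by blast
    then obtain z where "z \<in> ball 0 1" "\<phi> z = 0" by (metis imageE)
    with re[of z] show False by simp
  qed
  have bdd: "bdd_above A" using le1 by (auto simp: bdd_above_def)
  have "e \<in> A" using e by (simp add: A_def)
  then have "A \<noteq> {}" "e \<le> Sup A" using cSup_upper[OF _ bdd] by auto
  show ?thesis
  proof (rule that[of "Sup A"])
    show "0 < Sup A" using e(1) \<open>e \<le> Sup A\<close> by simp
    show "Sup A \<le> 1" using \<open>A \<noteq> {}\<close> le1 by (rule cSup_least)
    show "ball 1 (Sup A) \<subseteq> ?U"
    proof
      fix w :: complex assume "w \<in> ball 1 (Sup A)"
      then have "dist 1 w < Sup A" by simp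
      then obtain r where "r \<in> A" "dist 1 w < r"
        using less_cSup_iff[OF \<open>A \<noteq> {}\<close> bdd] by blast
      then show "w \<in> ?U" unfolding A_def by (auto simp del: image_iff)
    qed
    show "r \<le> Sup A" if "ball 1 r \<subseteq> ?U" for r
      using that by (intro cSup_upper bdd) (simp add: A_def)
  qed
qed

text \<open>At a value \<open>l\<close> of \<phi> the inverse function would be continuous, so the
  arguments x would converge to a point of the open disk; but they tend to -1.\<close>

lemma radial_limit_not_in_image:
  assumes "\<phi> holomorphic_on ball 0 1" "inj_on \<phi> (ball 0 1)"
    and lim: "((\<lambda>x::real. \<phi> (of_real x)) \<longlongrightarrow> l) (at_right (-1))"
  shows "l \<notin> \<phi> ` ball 0 1"
proof
  assume l: "l \<in> \<phi> ` ball 0 1"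
  obtain g where g: "g holomorphic_on (\<phi> ` ball 0 1)" "\<And>z. z \<in> ball 0 1 \<Longrightarrow> g (\<phi> z) = z"
    using holomorphic_has_inverse[OF assms(1) open_ball assms(2)] by metis
  have "open (\<phi> ` ball 0 1)"
    by (rule open_mapping_thm3[OF assms(1) open_ball assms(2)])
  then have "isCont g l"
    using holomorphic_on_imp_continuous_on[OF g(1)] l continuous_on_eq_continuous_at by blast
  then have "((\<lambda>x::real. g (\<phi> (of_real x))) \<longlongrightarrow> g l) (at_right (-1))"
    using lim by (rule isCont_tendsto_compose)
  moreover have "\<forall>\<^sub>F x in at_right (-1::real). g (\<phi> (of_real x)) = of_real x"
    unfolding eventually_at_right_field by (rule exI[of _ 0]) (auto intro!: g(2))
  ultimately have "((\<lambda>x::real. complex_of_real x) \<longlongrightarrow> g l) (at_right (-1))"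
    by (rule Lim_transform_eventually)
  moreover have "((\<lambda>x::real. complex_of_real x) \<longlongrightarrow> of_real (-1)) (at_right (-1))"
    by (intro tendsto_intros)
  ultimately have "g l = of_real (-1)"
    by (intro tendsto_unique) auto
  moreover obtain z where "z \<in> ball 0 1" "l = \<phi> z" using l by auto
  ultimately show False using g(2)[of z] by auto
qed

section \<open>The radius\<close>

text \<open>With E = exp (s L(z^k)) the equation for \<open>L\<close> gives z E' = - c Q(z^k) E,
  hence F' = E B with B = 1 - c Q(z^k). The last formula is the logarithmic derivative of this
  product.\<close>

lemma deriv_mult_exp_comp_power:
  fixes L Q :: "complex \<Rightarrow> complex" and s d W :: real and k :: nat
  assumes W: "d ^ k = W" "d > 0" and k: "k \<ge> 1"
    and l: "L holomorphic_on ball 0 W" and Q: "Q holomorphic_on ball 0 W"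
    and ode: "\<And>w. w \<in> ball 0 W \<Longrightarrow> w * deriv L w = - Q w"
    and nz: "\<And>w. w \<in> ball 0 W \<Longrightarrow> 1 - of_real (s * k) * Q w \<noteq> 0"
  defines "F \<equiv> \<lambda>z. z * exp (of_real s * L (z ^ k))"
  shows "F holomorphic_on ball 0 d"
    and "\<And>z. z \<in> ball 0 d \<Longrightarrow> deriv F z \<noteq> 0"
    and "\<And>z. z \<in> ball 0 d \<Longrightarrow> z * deriv (deriv F) z / deriv F z =
      - (of_real (s * k) * Q (z ^ k) +
         of_real (s * k * k) * (z ^ k * deriv Q (z ^ k)) / (1 - of_real (s * k) * Q (z ^ k)))"
proof -
  define c where "c = complex_of_real (s * k)"
  define E where "E z = exp (of_real s * L (z ^ k))" for z
  define B where "B z = 1 - c * Q (z ^ k)" for z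
  have pow: "z ^ k \<in> ball 0 W" if "z \<in> ball 0 d" for z :: complex
    using that W k by (auto simp: dist_norm norm_power intro!: power_strict_mono)
  have powk: "z * (of_nat k * z ^ (k - 1)) = of_nat k * z ^ k" for z :: complex
    using k by (cases k) auto
  have dl: "(L has_field_derivative deriv L w) (at w)" if "w \<in> ball 0 W" for w
    using l that by (auto intro: holomorphic_derivI)
  have dQ: "(Q has_field_derivative deriv Q w) (at w)" if "w \<in> ball 0 W" for w
    using Q that by (auto intro: holomorphic_derivI)
  define E' where "E' z = E z * (of_real s * (deriv L (z ^ k) * (of_nat k * z ^ (k - 1))))" for z
  define B' where "B' z = - (c * (deriv Q (z ^ k) * (of_nat k * z ^ (k - 1))))" for z
  have dE: "(E has_field_derivative E' z) (at z)" if "z \<in> ball 0 d" for z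
    unfolding E_def E'_def
    by (rule derivative_eq_intros DERIV_chain2[OF dl] pow that refl | simp)+
  have dB: "(B has_field_derivative B' z) (at z)" if "z \<in> ball 0 d" for z
    unfolding B_def B'_def
    by (rule derivative_eq_intros DERIV_chain2[OF dQ] pow that refl | simp)+
  have zE': "z * E' z = - (c * Q (z ^ k) * E z)" if "z \<in> ball 0 d" for z
  proof -
    have "z * E' z = E z * of_real s * deriv L (z ^ k) * (z * (of_nat k * z ^ (k - 1)))"
      by (simp add: E'_def)
    also have "\<dots> = E z * c * (z ^ k * deriv L (z ^ k))"
      unfolding powk c_def by simp
    finally show ?thesis using ode[OF pow[OF that]] by simp
  qed
  have zB': "z * B' z = - (of_real (s * k * k) * (z ^ k * deriv Q (z ^ k)))" for z
  proof -
    have "z * B' z = - (c * deriv Q (z ^ k) * (z * (of_nat k * z ^ (k - 1))))"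
      by (simp add: B'_def)
    then show ?thesis unfolding powk c_def by simp
  qed
  have F: "F = (\<lambda>z. z * E z)" by (simp add: F_def E_def)
  have dF: "(F has_field_derivative E z * B z) (at z)" if "z \<in> ball 0 d" for z
  proof -
    have "(F has_field_derivative E z + z * E' z) (at z)"
      unfolding F by (rule derivative_eq_intros dE that refl | simp)+
    then show ?thesis unfolding zE'[OF that] by (simp add: B_def algebra_simps)
  qed
  show "F holomorphic_on ball 0 d"
    unfolding holomorphic_on_open[OF open_ball] using dF by blast
  have nzEB: "E z \<noteq> 0" "B z \<noteq> 0" if "z \<in> ball 0 d" for z
    using nz[OF pow[OF that]] by (auto simp: E_def B_def c_def)
  show "deriv F z \<noteq> 0" if "z \<in> ball 0 d" for z
    using DERIV_imp_deriv[OF dF[OF that]] nzEB[OF that] by simp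
  show "z * deriv (deriv F) z / deriv F z =
      - (of_real (s * k) * Q (z ^ k) +
         of_real (s * k * k) * (z ^ k * deriv Q (z ^ k)) / (1 - of_real (s * k) * Q (z ^ k)))"
    if z: "z \<in> ball 0 d" for z
  proof -
    have "\<forall>\<^sub>F w in nhds z. deriv F w = E w * B w"
      by (rule eventually_nhds_in_open[THEN eventually_mono, of "ball 0 d"])
        (use z dF in \<open>auto intro: DERIV_imp_deriv\<close>)
    then have "deriv (deriv F) z = deriv (\<lambda>w. E w * B w) z"
      by (intro deriv_cong_ev) auto
    also have "\<dots> = E' z * B z + E z * B' z"
      by (rule DERIV_imp_deriv) (rule derivative_eq_intros dE dB z refl | simp)+
    finally have "z * deriv (deriv F) z = (z * E' z) * B z + E z * (z * B' z)"
      by (simp add: algebra_simps)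
    also have "\<dots> = E z * B z * (- (c * Q (z ^ k)) + (z * B' z) / B z)"
      unfolding zE'[OF z] using nzEB[OF z] by (simp add: field_simps)
    finally show ?thesis
      unfolding DERIV_imp_deriv[OF dF[OF z]] zB' using nzEB[OF z]
      by (simp add: c_def B_def)
  qed
qed

(* On |z| = r the quantity - z F''/F' has the largest modulus at z = r, where it is real. *)
lemma C_radius_of_majorized:
  fixes L Q :: "complex \<Rightarrow> complex" and s W b \<alpha> :: real and k :: nat
  defines "c \<equiv> s * k"
  assumes k: "k \<ge> 1" and s: "s > 0" and \<alpha>: "0 < \<alpha>" "\<alpha> \<le> 1"
    and l: "L holomorphic_on ball 0 W" and Q: "Q holomorphic_on ball 0 W"
    and ode: "\<And>w. w \<in> ball 0 W \<Longrightarrow> w * deriv L w = - Q w"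
    and Q_le: "\<And>w. w \<in> ball 0 W \<Longrightarrow> norm (Q w) \<le> Re (Q (of_real (norm w)))"
    and Q'_le: "\<And>w. w \<in> ball 0 W \<Longrightarrow>
      norm (w * deriv Q w) \<le> Re (of_real (norm w) * deriv Q (of_real (norm w)))"
    and Im_Q: "\<And>r. 0 \<le> r \<Longrightarrow> r < W \<Longrightarrow> Im (Q (of_real r)) = 0"
    and Im_Q': "\<And>r. 0 \<le> r \<Longrightarrow> r < W \<Longrightarrow> Im (of_real r * deriv Q (of_real r)) = 0"
    and lt1: "\<And>r. 0 \<le> r \<Longrightarrow> r < W \<Longrightarrow> c * Re (Q (of_real r)) < 1"
    and b: "0 < b" "b < W" "c * Re (Q (of_real b)) = 1 / 2"
      "Re (Q (of_real b)) \<le> Re (of_real b * deriv Q (of_real b))"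
    and germ: "\<forall>\<^sub>F z in nhds 0. f z = z * exp (of_real s * L (z ^ k))"
  obtains R where "\<And>\<psi>. ball 1 \<alpha> \<subseteq> \<psi> ` ball 0 1 \<Longrightarrow> of_real (1 - \<alpha>) \<notin> \<psi> ` ball 0 1 \<Longrightarrow>
    is_C_radius \<psi> f R"
proof -
  have c: "c > 0" using s k by (simp add: c_def)
  define D where "D w = w * deriv Q w" for w
  \<comment> \<open>\<open>G z\<close> is - z F''/F', and \<open>g r\<close> is its value at the
    point z = r of the positive axis.\<close>
  define G where "G z = of_real c * Q (z ^ k) + of_real (c * k) * D (z ^ k) / (1 - of_real c * Q (z ^ k))" for z
  define g where "g r = c * Re (Q (of_real (r ^ k))) +
    c * k * Re (D (of_real (r ^ k))) / (1 - c * Re (Q (of_real (r ^ k))))" for r :: real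
  define F where "F = (\<lambda>z. z * exp (of_real s * L (z ^ k)))"
  have k0: "0 < k" using k by simp
  \<comment> \<open>The radii \<open>d\<close> and \<open>d2\<close> in the variable z correspond to
    \<open>W\<close> and \<open>b\<close> in the variable w = z^k.\<close>
  obtain d where d: "d > 0" "d ^ k = W"
    using realpow_pos_nth[OF k0, of W] b by auto
  obtain d2 where d2: "d2 > 0" "d2 ^ k = b"
    using realpow_pos_nth[OF k0 b(1)] by auto
  have "d2 < d"
    using power_less_imp_less_base[of d2 k d] d d2 b by simp
  have pow: "r ^ k < W" if "0 \<le> r" "r < d" for r
    using power_strict_mono[OF that(2,1) k0] d by simp
  have less1: "c * norm (Q w) < 1" if "w \<in> ball 0 W" for w
  proof -
    have "c * norm (Q w) \<le> c * Re (Q (of_real (norm w)))"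
      using Q_le[OF that] c by simp
    also have "\<dots> < 1" using that by (intro lt1) auto
    finally show ?thesis .
  qed
  have nz: "1 - of_real c * Q w \<noteq> 0" if "w \<in> ball 0 W" for w
  proof
    assume "1 - of_real c * Q w = 0"
    then have "norm (of_real c * Q w) = 1" by (metis norm_one right_minus_eq)
    then show False using less1[OF that] c by (simp add: norm_mult)
  qed
  have FF: "F holomorphic_on ball 0 d" "\<And>z. z \<in> ball 0 d \<Longrightarrow> deriv F z \<noteq> 0"
    "\<And>z. z \<in> ball 0 d \<Longrightarrow> z * deriv (deriv F) z / deriv F z =
      - (of_real (s * k) * Q (z ^ k) +
         of_real (s * k * k) * (z ^ k * deriv Q (z ^ k)) / (1 - of_real (s * k) * Q (z ^ k)))"
    unfolding F_def
    by (rule deriv_mult_exp_comp_power[OF d(2,1) k l Q]; use ode nz in \<open>simp add: c_def\<close>)+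
  have conv: "1 + z * deriv (deriv F) z / deriv F z = 1 - G z" if "z \<in> ball 0 d" for z
    using FF(3)[OF that] by (simp add: G_def c_def D_def)
  have G_real: "G (of_real r) = of_real (g r)" if "0 \<le> r" "r < d" for r
  proof -
    have Q_real: "Q (of_real r ^ k) = of_real (Re (Q (of_real (r ^ k))))"
      and D_real: "D (of_real r ^ k) = of_real (Re (D (of_real (r ^ k))))"
      using Im_Q[of "r ^ k"] Im_Q'[of "r ^ k"] pow[OF that] that by (simp_all add: complex_eq_iff D_def)
    show ?thesis unfolding G_def g_def Q_real D_real by simp
  qed
  have G_le: "norm (G z) \<le> g (norm z)" if "z \<in> ball 0 d" for z
  proof -
    let ?w = "z ^ k"
    have w: "?w \<in> ball 0 W" using pow[of "norm z"] that by (simp add: norm_power)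
    let ?x = "Re (Q (of_real (norm ?w)))"
    let ?y = "Re (D (of_real (norm ?w)))"
    have x: "norm (Q ?w) \<le> ?x" "c * ?x < 1" using Q_le[OF w] lt1[of "norm ?w"] w by auto
    have y: "norm (D ?w) \<le> ?y" using Q'_le[OF w] by (simp add: D_def)
    \<comment> \<open>The reverse triangle inequality: passing to the positive axis makes the
      numerators of \<open>G\<close> larger and its denominator smaller.\<close>
    have "1 - c * ?x \<le> 1 - c * norm (Q ?w)" using x c by simp
    also have "\<dots> = norm (1::complex) - norm (of_real c * Q ?w)" using c by (simp add: norm_mult)
    also have "\<dots> \<le> norm (1 - of_real c * Q ?w)" by (rule norm_triangle_ineq2)
    finally have den: "1 - c * ?x \<le> norm (1 - of_real c * Q ?w)" .
    have "norm (G z) \<le> norm (of_real c * Q ?w) + norm (of_real (c * k) * D ?w / (1 - of_real c * Q ?w))"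
      unfolding G_def by (rule norm_triangle_ineq)
    also have "\<dots> = c * norm (Q ?w) + c * k * norm (D ?w) / norm (1 - of_real c * Q ?w)"
      using c by (simp add: norm_mult norm_divide)
    also have "\<dots> \<le> c * ?x + c * k * ?y / (1 - c * ?x)"
      using c x y den by (intro add_mono frac_le mult_left_mono mult_nonneg_nonneg) (auto intro: order_trans[OF norm_ge_zero])
    also have "\<dots> = g (norm z)" by (simp add: g_def norm_power)
    finally show ?thesis .
  qed
  have cont: "continuous_on {0..d2} g"
  proof -
    have im: "(\<lambda>r. complex_of_real (r ^ k)) ` {0..d2} \<subseteq> ball 0 W"
      using pow \<open>d2 < d\<close> by (auto simp: norm_power)
    have "continuous_on (ball 0 W) Q" "continuous_on (ball 0 W) D"
      unfolding D_def using Q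
      by (auto intro!: holomorphic_on_imp_continuous_on holomorphic_intros)
    then have "continuous_on {0..d2} (\<lambda>r. Q (of_real (r ^ k)))"
      "continuous_on {0..d2} (\<lambda>r. D (of_real (r ^ k)))"
      using im by (auto intro!: continuous_on_compose2[of "ball 0 W" Q] continuous_on_compose2[of "ball 0 W" D]
        continuous_intros simp del: of_real_power)
    moreover have "1 - c * Re (Q (of_real (r ^ k))) \<noteq> 0" if "r \<in> {0..d2}" for r
      using lt1[of "r ^ k"] pow[of r] \<open>d2 < d\<close> that by auto
    ultimately show ?thesis
      unfolding g_def by (intro continuous_intros) blast+
  qed
  have "Q 0 = 0" using ode[of 0] b by simp
  then have g0: "g 0 = 0" using k0 by (simp add: g_def D_def zero_power)
  \<comment> \<open>At \<open>b\<close> the denominator is 1/2 and the numerator of the fraction at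
    least 1/2, so the fraction alone is at least 1, which is at least \<alpha>.\<close>
  have gd2: "\<alpha> \<le> g d2"
  proof -
    have "1 / 2 \<le> c * Re (D (of_real b))"
      using mult_left_mono[OF b(4), of c] b(3) c by (simp add: D_def)
    also have "\<dots> \<le> real k * (c * Re (D (of_real b)))"
      using k calculation mult_right_mono[of 1 "real k" "c * Re (D (of_real b))"] by simp
    finally have "1/2 \<le> c * k * Re (D (of_real b))" by (simp add: mult_ac)
    then have "g d2 \<ge> 1" unfolding g_def d2(2) b(3) by simp
    then show ?thesis using \<alpha> by simp
  qed
  \<comment> \<open>Taking \<open>R\<close> as the first point where \<open>g\<close> reaches
    \<alpha> yields g < \<alpha> before \<open>R\<close> directly, without an argument on
    monotonicity.\<close>
  define S where "S = {r \<in> {0..d2}. \<alpha> \<le> g r}"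
  have "S = {0..d2} \<inter> g -` {\<alpha>..}" by (auto simp: S_def)
  then have "closed S" using continuous_closed_preimage[OF cont, of "{\<alpha>..}"] by simp
  define R where "R = Inf S"
  have "S \<noteq> {}" "bdd_below S" using gd2 d2 by (auto simp: S_def)
  then have "R \<in> S" unfolding R_def using \<open>closed S\<close> by (intro closed_contains_Inf) auto
  then have R: "0 \<le> R" "R \<le> d2" "\<alpha> \<le> g R" by (auto simp: S_def)
  have Rleast: "g r < \<alpha>" if "0 \<le> r" "r < R" for r
  proof (rule ccontr)
    assume "\<not> g r < \<alpha>"
    then have "r \<in> S" using that R by (simp add: S_def)
    then have "R \<le> r" unfolding R_def using \<open>bdd_below S\<close> by (rule cInf_lower)
    with that show False by simp
  qed
  \<comment> \<open>Since \<open>g\<close> starts at 0, it takes the value \<alpha> at some point up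
    to \<open>R\<close>; by the choice of \<open>R\<close> that point is \<open>R\<close>
    itself.\<close>
  have "\<exists>x\<ge>0. x \<le> R \<and> g x = \<alpha>"
    using R g0 \<alpha> by (intro IVT' continuous_on_subset[OF cont]) auto
  then have gR: "g R = \<alpha>" using Rleast by (metis less_irrefl order_le_less)
  have R0: "R > 0" using gR g0 R(1) \<alpha> by (cases "R = 0") auto
  have Rd: "R < d" using R \<open>d2 < d\<close> by simp
  show ?thesis
  proof (rule that)
    \<comment> \<open>\<open>R\<close> is fixed before \<psi> enters, so one radius serves every
      \<psi> whose image contains the disk and omits 1 - \<alpha>.\<close>
    fix \<psi> :: "complex \<Rightarrow> complex"
    assume \<psi>: "ball 1 \<alpha> \<subseteq> \<psi> ` ball 0 1" "of_real (1 - \<alpha>) \<notin> \<psi> ` ball 0 1"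
    have "convex_type_in \<psi> f R"
      unfolding convex_type_in_def
    proof (intro exI[of _ F] conjI ballI)
      show "F holomorphic_on ball 0 R" using FF(1) by (rule holomorphic_on_subset) (use Rd in auto)
      show "\<forall>\<^sub>F z in nhds 0. F z = f z" using germ by (auto simp: F_def elim: eventually_mono)
      fix z :: complex assume z: "z \<in> ball 0 R"
      then have zd: "z \<in> ball 0 d" using Rd by simp
      show "deriv F z \<noteq> 0" by (rule FF(2)[OF zd])
      have "norm (G z) < \<alpha>" using G_le[OF zd] Rleast[of "norm z"] z by simp
      then have "1 - G z \<in> ball 1 \<alpha>" by (simp add: dist_norm)
      then show "1 + z * deriv (deriv F) z / deriv F z \<in> \<psi> ` ball 0 1"
        unfolding conv[OF zd] using \<psi>(1) by blast
    qed
    moreover have "r \<le> R" if r: "r > 0" "convex_type_in \<psi> f r" for r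
    proof (rule ccontr)
      assume "\<not> r \<le> R"
      from r obtain H where H: "H holomorphic_on ball 0 r" "\<forall>\<^sub>F z in nhds 0. H z = f z"
        and Hin: "\<And>z. z \<in> ball 0 r \<Longrightarrow> 1 + z * deriv (deriv H) z / deriv H z \<in> \<psi> ` ball 0 1"
        unfolding convex_type_in_def by blast
      \<comment> \<open>A continuation \<open>H\<close> to a disk of radius beyond \<open>R\<close>
        agrees with \<open>F\<close> on \<open>U\<close> by the identity theorem. As
        \<open>R\<close> lies in \<open>U\<close>, the derivatives agree there as well, and the
        omitted value 1 - \<alpha> would be taken.\<close>
      define U where "U = ball (0::complex) (min r d)"
      have "\<forall>\<^sub>F z in nhds 0. H z = F z"
        using H(2) germ by eventually_elim (simp add: F_def)
      then obtain T where T: "open T" "0 \<in> T" "\<And>z. z \<in> T \<Longrightarrow> H z = F z"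
        by (auto simp: eventually_nhds)
      have eq: "H z = F z" if "z \<in> U" for z
      proof (rule analytic_continuation_open[of "T \<inter> U" U H F z])
        show "T \<inter> U \<noteq> {}" using T r d by (auto simp: U_def)
        show "H holomorphic_on U" "F holomorphic_on U"
          by (auto simp: U_def intro: holomorphic_on_subset[OF H(1)] holomorphic_on_subset[OF FF(1)])
      qed (use T that in \<open>auto simp: U_def\<close>)
      have RU: "of_real R \<in> U" using \<open>\<not> r \<le> R\<close> Rd R0 by (simp add: U_def)
      then have "\<forall>\<^sub>F z in nhds (of_real R). H z = F z"
        using eventually_nhds_in_open[of U "of_real R"] eq by (auto simp: U_def elim: eventually_mono)
      then have "deriv H (of_real R) = deriv F (of_real R)"
        "deriv (deriv H) (of_real R) = deriv (deriv F) (of_real R)"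
        using higher_deriv_cong_ev[of H F "of_real R" "of_real R" 1]
          higher_deriv_cong_ev[of H F "of_real R" "of_real R" 2] by (auto simp: numeral_2_eq_2)
      then have "1 - G (of_real R) \<in> \<psi> ` ball 0 1"
        using Hin[of "of_real R"] conv[of "of_real R"] \<open>\<not> r \<le> R\<close> Rd R0 by simp
      moreover have "1 - G (of_real R) = of_real (1 - \<alpha>)"
        using G_real[of R] gR R0 Rd by simp
      ultimately show False using \<psi>(2) by simp
    qed
    ultimately show "is_C_radius \<psi> f R"
      using R0 by (auto simp: is_C_radius_def)
  qed
qed

section \<open>Wright functions\<close>

definition wright_fps :: "real \<Rightarrow> real \<Rightarrow> real fps" where
  "wright_fps \<rho> \<beta> = Abs_fps (\<lambda>n. Gamma \<beta> * (-1) ^ n / (fact n * Gamma (real n * \<rho> + \<beta>)))"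

text \<open>Once n \<rho> \<ge> 2, the Gamma factor in the denominator is at least Gamma 2 = 1 by
  monotonicity, so an exponential series dominates.\<close>

lemma fps_conv_radius_wright_fps:
  assumes "\<rho> > 0" "\<beta> > 0"
  shows "fps_conv_radius (complex_fps (wright_fps \<rho> \<beta>)) = \<infinity>"
  unfolding fps_conv_radius_def
proof (rule conv_radius_inftyI'')
  fix z :: complex
  have "summable (\<lambda>n. Gamma \<beta> * (norm z ^ n /\<^sub>R fact n))"
    by (intro summable_mult summable_exp_generic)
  moreover have "\<forall>\<^sub>F n in sequentially. norm (fps_nth (complex_fps (wright_fps \<rho> \<beta>)) n * z ^ n)
      \<le> Gamma \<beta> * (norm z ^ n /\<^sub>R fact n)"
  proof -
    have "\<forall>\<^sub>F n in sequentially. real n \<ge> 2 / \<rho>"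
      by (rule eventually_at_top_linorderI[of "nat \<lceil>2 / \<rho>\<rceil>"]) linarith
    then show ?thesis
    proof eventually_elim
      case (elim n)
      then have "2 \<le> real n * \<rho> + \<beta>" using assms by (simp add: field_simps)
      moreover have "Gamma (2::real) = 1" using Gamma_fact[of 1] by simp
      ultimately have *: "1 \<le> Gamma (real n * \<rho> + \<beta>)"
        using Gamma_real_strict_mono[of 2 "real n * \<rho> + \<beta>"] by (cases "real n * \<rho> + \<beta> = 2") auto
      have "norm (fps_nth (complex_fps (wright_fps \<rho> \<beta>)) n * z ^ n) =
          Gamma \<beta> * (norm z ^ n / fact n) / Gamma (real n * \<rho> + \<beta>)"
        using * assms(2)[THEN Gamma_real_pos]
        by (simp add: wright_fps_def norm_mult norm_power norm_divide abs_mult abs_divide power_abs divide_simps)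
      also have "\<dots> \<le> Gamma \<beta> * (norm z ^ n / fact n) / 1"
        using * assms(2)[THEN Gamma_real_pos] by (intro divide_left_mono mult_nonneg_nonneg) auto
      finally show ?case by (simp add: divide_inverse mult_ac)
    qed
  qed
  ultimately show "summable (\<lambda>n. fps_nth (complex_fps (wright_fps \<rho> \<beta>)) n * z ^ n)"
    by (rule summable_comparison_test_ev[rotated])
qed

lemma eval_wright_fps:
  assumes "\<rho> > 0" "\<beta> > 0"
  shows "eval_fps (complex_fps (wright_fps \<rho> \<beta>)) w = of_real (Gamma \<beta>) * wright \<rho> \<beta> (- w)"
proof -
  let ?t = "\<lambda>n. (- w) ^ n / (fact n * complex_of_real (Gamma (real n * \<rho> + \<beta>)))"
  have *: "complex_fps (wright_fps \<rho> \<beta>) $ n * w ^ n = of_real (Gamma \<beta>) * ?t n" for n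
    by (simp add: wright_fps_def power_minus[of w])
  have "summable (\<lambda>n. complex_fps (wright_fps \<rho> \<beta>) $ n * w ^ n)"
    by (rule summable_fps) (simp add: fps_conv_radius_wright_fps assms)
  then have "summable (\<lambda>n. of_real (Gamma \<beta>) * ?t n)"
    unfolding * .
  then have "summable ?t"
    by (rule summable_mult_D) (use Gamma_real_pos[OF assms(2)] in \<open>simp del: Gamma_real_pos\<close>)
  then show ?thesis
    unfolding eval_fps_def wright_def * by (rule suminf_mult)
qed

text \<open>The normalized function enters only through its germ. The assumption \<open>germ\<close>
  ranges over all logarithms vanishing at 0, since the actual \<open>L\<close> and \<open>W\<close>
  are constructed inside the proof.\<close>

lemma wright_type_C_radius:
  fixes \<rho> \<beta> s \<alpha> :: real and k :: nat
  assumes "\<rho> > 0" "\<beta> > 0" and s: "s > 0" and k: "k \<ge> 1" and \<alpha>: "0 < \<alpha>" "\<alpha> \<le> 1"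
    and germ: "\<And>L W. W > 0 \<Longrightarrow> L holomorphic_on ball 0 W \<Longrightarrow> L 0 = 0 \<Longrightarrow>
      (\<And>w. w \<in> ball 0 W \<Longrightarrow> exp (L w) = of_real (Gamma \<beta>) * wright \<rho> \<beta> (- w)) \<Longrightarrow>
      \<forall>\<^sub>F z in nhds 0. f z = z * exp (of_real s * L (z ^ k))"
  obtains R where "\<And>\<psi>. ball 1 \<alpha> \<subseteq> \<psi> ` ball 0 1 \<Longrightarrow> of_real (1 - \<alpha>) \<notin> \<psi> ` ball 0 1 \<Longrightarrow>
    is_C_radius \<psi> f R"
proof -
  define c where "c = s * k"
  have c: "c > 0" using s k by (simp add: c_def)
  define p where "p = wright_fps \<rho> \<beta>"
  define q where "q = neg_log_deriv p"
  define q' where "q' = fps_X * fps_deriv q"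
  define P where "P = eval_fps (complex_fps p)"
  define Q where "Q = eval_fps (complex_fps q)"
  have p: "neg_log_mono p" unfolding p_def wright_fps_def by (rule neg_log_mono_wright[OF assms(1,2)])
  have rad_p: "fps_conv_radius (complex_fps p) = \<infinity>"
    unfolding p_def by (rule fps_conv_radius_wright_fps[OF assms(1,2)])
  have p0: "p $ 0 = 1" "p $ 1 \<noteq> 0"
    using less_imp_neq[OF Gamma_real_pos[of \<beta>]] less_imp_neq[OF Gamma_real_pos[of "\<rho> + \<beta>"]] assms(1,2)
    by (simp_all add: p_def wright_fps_def)
  have q: "q $ n \<ge> 0" "q $ 0 = 0" for n using p by (auto simp: q_def neg_log_mono_def)
  have q'_nth: "q' $ n = real n * q $ n" for n by (simp add: q'_def fps_X_mult_deriv_nth del: fps_X_mult_nth)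
  have q': "q' $ n \<ge> 0" for n using q by (simp add: q'_nth)
  obtain r where r: "r > 0" "r < fps_conv_radius (complex_fps q)"
    "\<And>w. norm w \<le> r \<Longrightarrow> P w \<noteq> 0" "1 / c \<le> Re (Q (of_real r))"
    using neg_log_deriv_unbounded[OF p p0(2) rad_p, of "1 / c"] unfolding P_def Q_def q_def by metis
  have in_rad: "ereal x < fps_conv_radius (complex_fps q)" if "x \<le> r" for x
    using le_less_trans[OF _ r(2), of "ereal x"] that by simp
  have holQ: "Q holomorphic_on ball 0 r"
    unfolding Q_def by (intro holomorphic_on_eval_fps) (auto simp: in_rad)
  have cont: "continuous_on {0..r} (\<lambda>x. c * Re (Q (of_real x)))"
    unfolding Q_def using in_rad by (intro continuous_intros) auto
  have Q0: "Q 0 = 0" by (simp add: Q_def eval_fps_at_0 q)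
  \<comment> \<open>The value 3/4 lies strictly between 1/2 and 1: it keeps c Q below 1 on the disk
    of radius \<open>W\<close> and leaves room for a point \<open>b\<close> below \<open>W\<close>
    with c Q = 1/2.\<close>
  have "\<exists>x\<ge>0. x \<le> r \<and> c * Re (Q (of_real x)) = 3/4"
    using r(1,4) c Q0 by (intro IVT' cont) (auto simp: field_simps)
  then obtain W where W: "0 \<le> W" "W \<le> r" "c * Re (Q (of_real W)) = 3/4" by blast
  have "\<exists>x\<ge>0. x \<le> W \<and> c * Re (Q (of_real x)) = 1/2"
    using W Q0 by (intro IVT' continuous_on_subset[OF cont]) auto
  then obtain b where b: "0 \<le> b" "b \<le> W" "c * Re (Q (of_real b)) = 1/2" by blast
  have b0: "b > 0" using b Q0 by (cases "b = 0") auto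
  have bW: "b < W" using b W by (cases "b = W") auto
  have W_rad: "ereal x < fps_conv_radius (complex_fps q)" if "x \<le> W" for x
    using in_rad that W(2) by simp
  have "complex_fps q' = fps_X * fps_deriv (complex_fps q)"
    by (rule fps_ext) (simp add: q'_nth fps_X_mult_deriv_nth del: fps_X_mult_nth)
  moreover have rad_dq: "fps_conv_radius (fps_deriv (complex_fps q)) \<ge> fps_conv_radius (complex_fps q)"
    by (simp add: fps_conv_radius_deriv)
  ultimately have rad_q': "fps_conv_radius (complex_fps q') \<ge> fps_conv_radius (complex_fps q)"
    and Q': "ereal (norm w) < fps_conv_radius (complex_fps q) \<Longrightarrow> w * deriv Q w = eval_fps (complex_fps q') w" for w
    using fps_conv_radius_mult[of fps_X "fps_deriv (complex_fps q)"]
    by (auto simp: Q_def eval_fps_mult eval_fps_deriv intro: order_trans less_le_trans)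
  have W_rad': "ereal x < fps_conv_radius (complex_fps q')" if "x \<le> W" for x
    using W_rad[OF that] rad_q' by (rule less_le_trans)
  have Pnz: "P w \<noteq> 0" if "w \<in> ball 0 W" for w
    using r(3)[of w] that W by simp
  have holP: "P holomorphic_on ball 0 W"
    unfolding P_def by (rule holomorphic_on_eval_fps) (simp add: rad_p)
  obtain M where M: "M holomorphic_on ball 0 W" "\<And>w. w \<in> ball 0 W \<Longrightarrow> P w = exp (M w)"
    using contractible_imp_holomorphic_log[OF holP convex_imp_contractible[OF convex_ball] Pnz] by metis
  \<comment> \<open>Subtracting \<open>M 0\<close> selects the branch vanishing at 0; it is still a
    logarithm of \<open>P\<close> because P 0 = 1.\<close>
  define L where "L w = M w - M 0" for w
  have holL: "L holomorphic_on ball 0 W"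
    unfolding L_def by (intro holomorphic_intros M)
  have "exp (M 0) = 1" using M(2)[of 0] b0 bW p0 by (simp add: P_def eval_fps_at_0)
  then have expL: "exp (L w) = P w" if "w \<in> ball 0 W" for w
    using M(2)[OF that] by (simp add: L_def exp_diff)
  have ode: "w * deriv L w = - Q w" if w: "w \<in> ball 0 W" for w
  proof -
    have dL: "(L has_field_derivative deriv L w) (at w)"
      using holL w by (auto intro: holomorphic_derivI)
    have "((\<lambda>w. exp (L w)) has_field_derivative exp (L w) * deriv L w) (at w)"
      by (rule derivative_eq_intros dL refl)+
    then have "(P has_field_derivative exp (L w) * deriv L w) (at w)"
      by (rule has_field_derivative_transform_within_open[OF _ open_ball w expL])
    then have "deriv P w = P w * deriv L w"
      using expL[OF w] by (simp add: DERIV_imp_deriv)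
    moreover have "Q w * P w = - (w * deriv P w)"
      unfolding Q_def q_def P_def using w W_rad[of "norm w"] p0 rad_p
      by (intro eval_neg_log_deriv) (auto simp: q_def)
    ultimately have "P w * (w * deriv L w) = P w * (- Q w)" by (simp add: algebra_simps)
    then show ?thesis using Pnz[OF w] by (rule mult_left_cancel[THEN iffD1, rotated])
  qed
  show ?thesis
  proof (rule C_radius_of_majorized[OF k s \<alpha> holL, where Q = Q and b = b and f = f])
    show "w * deriv L w = - Q w" if "w \<in> ball 0 W" for w by (rule ode[OF that])
    show "Q holomorphic_on ball 0 W" using holQ by (rule holomorphic_on_subset) (use W in auto)
    show "norm (Q w) \<le> Re (Q (of_real (norm w)))" if "w \<in> ball 0 W" for w
      unfolding Q_def using that by (intro norm_eval_complex_fps_le q W_rad) simp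
    show "norm (w * deriv Q w) \<le> Re (of_real (norm w) * deriv Q (of_real (norm w)))"
      if "w \<in> ball 0 W" for w
    proof -
      have "w * deriv Q w = eval_fps (complex_fps q') w"
        "of_real (norm w) * deriv Q (of_real (norm w)) = eval_fps (complex_fps q') (of_real (norm w))"
        using that W_rad[of "norm w"] by (simp_all add: Q')
      then show ?thesis using norm_eval_complex_fps_le[OF q', of w] W_rad'[of "norm w"] that by simp
    qed
    show "Im (Q (of_real x)) = 0" if "0 \<le> x" "x < W" for x
      unfolding Q_def using that by (intro sums_eval_complex_fps q W_rad) auto
    show "Im (of_real x * deriv Q (of_real x)) = 0" if "0 \<le> x" "x < W" for x
    proof -
      have "of_real x * deriv Q (of_real x) = eval_fps (complex_fps q') (of_real x)"
        using that W_rad[of x] by (simp add: Q')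
      then show ?thesis using sums_eval_complex_fps(2)[OF q', of x] W_rad'[of x] that by simp
    qed
    show "s * k * Re (Q (of_real x)) < 1" if "0 \<le> x" "x < W" for x
    proof -
      have "Re (Q (of_real x)) \<le> Re (Q (of_real W))"
        unfolding Q_def using that W_rad by (intro eval_complex_fps_mono q) auto
      then have "c * Re (Q (of_real x)) \<le> 3/4" using W(3) c by (metis mult_left_mono less_imp_le)
      then show ?thesis by (simp add: c_def)
    qed
    show "0 < b" "b < W" by fact+
    show "s * k * Re (Q (of_real b)) = 1 / 2" using b(3) by (simp add: c_def)
    show "Re (Q (of_real b)) \<le> Re (of_real b * deriv Q (of_real b))"
    proof -
      have "of_real b * deriv Q (of_real b) = eval_fps (complex_fps q') (of_real b)"
        using b0 bW W_rad[of b] by (simp add: Q')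
      \<comment> \<open>Termwise comparison: the n-th coefficient of \<open>q'\<close> is n times
        that of \<open>q\<close>, and the index 0 does no harm because \<open>q $ 0\<close>
        vanishes.\<close>
      moreover have "Re (Q (of_real b)) \<le> Re (eval_fps (complex_fps q') (of_real b))"
      proof (rule sums_le)
        show "(\<lambda>n. q $ n * b ^ n) sums Re (Q (of_real b))"
          unfolding Q_def using b by (intro sums_eval_complex_fps q W_rad) auto
        show "(\<lambda>n. q' $ n * b ^ n) sums Re (eval_fps (complex_fps q') (of_real b))"
          using b by (intro sums_eval_complex_fps q' W_rad') auto
        show "q $ n * b ^ n \<le> q' $ n * b ^ n" for n
        proof (cases n)
          case (Suc m)
          then have "1 * q $ n \<le> real n * q $ n" using q by (intro mult_right_mono) auto
          then show ?thesis using b0 by (intro mult_right_mono) (auto simp: q'_nth)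
        qed (simp add: q q'_nth)
      qed
      ultimately show ?thesis by simp
    qed
    show "\<forall>\<^sub>F z in nhds 0. f z = z * exp (of_real s * L (z ^ k))"
    proof (rule germ[OF _ holL])
      show "W > 0" using b0 bW by simp
      show "L 0 = 0" by (simp add: L_def)
      show "exp (L w) = of_real (Gamma \<beta>) * wright \<rho> \<beta> (- w)" if "w \<in> ball 0 W" for w
        using expL[OF that] eval_wright_fps[OF assms(1,2)] by (simp add: P_def p_def)
    qed
  qed (use that in blast)+
qed

lemma eventually_power_in_ball:
  assumes "(W::real) > 0" "k \<ge> 1"
  shows "\<forall>\<^sub>F z :: complex in nhds 0. z ^ k \<in> ball 0 W"
proof -
  have "((\<lambda>z::complex. z ^ k) \<longlongrightarrow> 0 ^ k) (nhds 0)" by (intro tendsto_intros filterlim_ident)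
  then show ?thesis
    using assms by (intro topological_tendstoD) (auto simp: zero_power)
qed

theorem theorem2p4:
  fixes \<rho> \<beta> :: real and \<phi> :: "complex \<Rightarrow> complex"
  assumes "\<rho> > 0" and "\<beta> > 0" and "ma_minda \<phi>"
  shows "\<exists>\<alpha>::real. 0 < \<alpha> \<and> \<alpha> \<le> 1 \<and>
           ball 1 \<alpha> \<subseteq> \<phi> ` ball 0 1 \<and>
           (\<forall>r. ball 1 r \<subseteq> \<phi> ` ball 0 1 \<longrightarrow> r \<le> \<alpha>) \<and>
           (((\<lambda>x::real. \<phi> (of_real x)) \<longlongrightarrow> of_real (1 - \<alpha>)) (at_right (-1)) \<longrightarrow>
              (\<forall>f\<in>{wright_f \<rho> \<beta>, wright_g \<rho> \<beta>, wright_h \<rho> \<beta>}.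
                 \<exists>R. is_C_radius \<phi> f R \<and> is_C_radius (\<lambda>z. 1 + of_real \<alpha> * z) f R))"
proof -
  obtain \<alpha> where \<alpha>: "0 < \<alpha>" "\<alpha> \<le> 1" "ball 1 \<alpha> \<subseteq> \<phi> ` ball 0 1"
    "\<And>r. ball 1 r \<subseteq> \<phi> ` ball 0 1 \<Longrightarrow> r \<le> \<alpha>"
    using ma_minda_max_disk[OF assms(3)] by metis
  have disk: "(\<lambda>z. 1 + of_real \<alpha> * z) ` ball 0 1 = ball (1::complex) \<alpha>"
  proof (intro equalityI subsetI)
    fix w :: complex assume "w \<in> ball 1 \<alpha>"
    then have "(w - 1) / of_real \<alpha> \<in> ball 0 1" "w = 1 + of_real \<alpha> * ((w - 1) / of_real \<alpha>)"
      using \<alpha>(1) by (simp_all add: norm_divide dist_norm norm_minus_commute)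
    then show "w \<in> (\<lambda>z. 1 + of_real \<alpha> * z) ` ball 0 1" by blast
  qed (use \<alpha>(1) in \<open>auto simp: dist_norm norm_mult\<close>)
  \<comment> \<open>The point 1 - \<alpha> lies on the boundary circle of the disk, so the image of
    1 + \<alpha> z omits it just as the image of \<phi> does.\<close>
  have notin: "complex_of_real (1 - \<alpha>) \<notin> (\<lambda>z. 1 + of_real \<alpha> * z) ` ball 0 1"
    unfolding disk using \<alpha>(1) by (simp add: dist_norm)
  have "\<exists>R. is_C_radius \<phi> f R \<and> is_C_radius (\<lambda>z. 1 + of_real \<alpha> * z) f R"
    if lim: "((\<lambda>x::real. \<phi> (of_real x)) \<longlongrightarrow> of_real (1 - \<alpha>)) (at_right (-1))"
      and f: "f \<in> {wright_f \<rho> \<beta>, wright_g \<rho> \<beta>, wright_h \<rho> \<beta>}" for f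
  proof -
    have \<phi>: "complex_of_real (1 - \<alpha>) \<notin> \<phi> ` ball 0 1"
      using assms(3) lim by (intro radial_limit_not_in_image) (auto simp: ma_minda_def)
    consider "f = wright_f \<rho> \<beta>" | "f = wright_g \<rho> \<beta>" | "f = wright_h \<rho> \<beta>" using f by blast
    then obtain R where "\<And>\<psi>. ball 1 \<alpha> \<subseteq> \<psi> ` ball 0 1 \<Longrightarrow> of_real (1 - \<alpha>) \<notin> \<psi> ` ball 0 1 \<Longrightarrow>
      is_C_radius \<psi> f R"
    proof cases
      case 1
      have "\<forall>\<^sub>F z in nhds 0. f z = z * exp (of_real (1 / \<beta>) * L (z ^ 2))"
        if W: "W > 0" and L: "L holomorphic_on ball 0 W" "L 0 = 0"
          "\<And>w. w \<in> ball 0 W \<Longrightarrow> exp (L w) = of_real (Gamma \<beta>) * wright \<rho> \<beta> (- w)" for L W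
      proof -
        have "continuous_on (ball 0 W) L" using L(1) by (rule holomorphic_on_imp_continuous_on)
        then have "isCont L 0" using W by (simp add: continuous_on_eq_continuous_at)
        moreover have "((\<lambda>z::complex. z ^ 2) \<longlongrightarrow> 0) (nhds 0)"
          by (rule tendsto_eq_intros filterlim_ident | simp)+
        ultimately have "((\<lambda>z. L (z ^ 2)) \<longlongrightarrow> 0) (nhds 0)"
          using isCont_tendsto_compose[of 0 L] L(2) by fastforce
        \<comment> \<open>Where |L| < pi, \<open>Ln\<close> undoes \<open>exp\<close>, so the
          principal power in \<open>wright_f\<close> coincides with exp (L / \<beta>). Near 0 this
          holds because L 0 = 0.\<close>
        then have "\<forall>\<^sub>F z in nhds 0. L (z ^ 2) \<in> ball 0 pi"
          by (intro topological_tendstoD) auto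
        with eventually_power_in_ball[OF W, where k = 2, OF one_le_numeral] show ?thesis
        proof eventually_elim
          case (elim z)
          have "\<bar>Im (L (z ^ 2))\<bar> < pi"
            using elim(2) abs_Im_le_cmod[of "L (z ^ 2)"] by simp
          then have "Ln (exp (L (z ^ 2))) = L (z ^ 2)" by (intro Ln_exp) auto
          then show ?case
            using L(3)[OF elim(1), symmetric] by (simp add: 1 wright_f_def powr_def)
        qed
      qed
      then show ?thesis
        using wright_type_C_radius[OF assms(1,2) _ _ \<alpha>(1,2), of "1 / \<beta>" 2 f] assms(2) that by auto
    next
      case 2
      have "\<forall>\<^sub>F z in nhds 0. f z = z * exp (of_real 1 * L (z ^ 2))"
        if "W > 0" "\<And>w. w \<in> ball 0 W \<Longrightarrow> exp (L w) = of_real (Gamma \<beta>) * wright \<rho> \<beta> (- w)" for L W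
        using eventually_power_in_ball[OF that(1), where k = 2, OF one_le_numeral]
        by eventually_elim (use that(2) in \<open>simp add: 2 wright_g_def mult.assoc\<close>)
      then show ?thesis
        using wright_type_C_radius[OF assms(1,2) _ _ \<alpha>(1,2), of 1 2 f] that by auto
    next
      case 3
      have "\<forall>\<^sub>F z in nhds 0. f z = z * exp (of_real 1 * L (z ^ 1))"
        if "W > 0" "\<And>w. w \<in> ball 0 W \<Longrightarrow> exp (L w) = of_real (Gamma \<beta>) * wright \<rho> \<beta> (- w)" for L W
        using eventually_power_in_ball[OF that(1) le_refl]
        by eventually_elim (use that(2) in \<open>simp add: 3 wright_h_def mult.assoc\<close>)
      then show ?thesis
        using wright_type_C_radius[OF assms(1,2) _ _ \<alpha>(1,2), of 1 1 f] that by auto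
    qed
    then show ?thesis using \<phi> notin \<alpha>(3) disk by (intro exI[of _ R]) auto
  qed
  then show ?thesis using \<alpha> by blast
qed

end
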